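(* Let $S_0,S_1$ be self-adjoint complex $d\times d$ matrices such that $\lambda(S_0+S_1)=\big(\lambda(S_0)+\lambda^\uparrow(S_1)\big)^\downarrow$. Then $S_0$ and $S_1$ commute.
   Context: For a self-adjoint $d\times d$ matrix $S$, $\lambda(S)\in\mathbb R^d$ is the vector of its eigenvalues, counted with multiplicity, in decreasing order, and $\lambda^\uparrow(S)$ is the same vector in increasing order. For $x\in\mathbb R^d$, $x^\downarrow$ is its decreasing rearrangement. *)

theory Defs
  imports "HOL-Library.Multiset" "Jordan_Normal_Form.Schur_Decomposition"
begin

definition self_adjoint :: "complex mat \<Rightarrow> bool" where
  "self_adjoint S \<longleftrightarrow> square_mat S \<and> mat_adjoint S = S"

text \<open>
  Vectors of \<open>\<real>\<^sup>d\<close> are lists of length \<open>d\<close>, since they have to be rearranged. The eigenvalues of a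
  self-adjoint matrix are taken with their multiplicity as roots of the characteristic polynomial;
  they are real, so \<^const>\<open>Re\<close> only changes the type
  (see \<open>char_poly_eigenvalues_incr\<close> and \<open>length_eigenvalues_incr\<close> below).
\<close>

definition eigenvalues_incr :: "complex mat \<Rightarrow> real list" where
  "eigenvalues_incr S = sorted_list_of_multiset (image_mset Re (proots (char_poly S)))"

definition decr_rearrangement :: "real list \<Rightarrow> real list" where
  "decr_rearrangement xs = rev (sort xs)"

definition eigenvalues_decr :: "complex mat \<Rightarrow> real list" where
  "eigenvalues_decr S = rev (eigenvalues_incr S)"

lemma self_adjoint_eigenvalue_real:
  assumes S: "S \<in> carrier_mat d d" and sa: "self_adjoint S" and k: "eigenvalue S k"
  shows "k \<in> \<real>"
proof -
  obtain v where v: "v \<in> carrier_vec d" "v \<noteq> 0\<^sub>v d" "S *\<^sub>v v = k \<cdot>\<^sub>v v"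
    using k S unfolding eigenvalue_def eigenvector_def by auto
  have adj: "S $$ (i, j) = cnj (S $$ (j, i))" if "i < d" "j < d" for i j
  proof -
    have "S $$ (i, j) = mat_adjoint S $$ (i, j)"
      using sa unfolding self_adjoint_def by simp
    also have "\<dots> = cnj (S $$ (j, i))"
      using that S by (simp add: mat_adjoint_def mat_of_rows_def)
    finally show ?thesis .
  qed
  define q where "q = (\<Sum>i<d. \<Sum>j<d. cnj (v $ i) * S $$ (i, j) * v $ j)"
  define n where "n = (\<Sum>i<d. cnj (v $ i) * v $ i)"
  have Sv: "(\<Sum>j<d. S $$ (i, j) * v $ j) = k * v $ i" if "i < d" for i
  proof -
    have "(S *\<^sub>v v) $ i = k * v $ i" using v that by simp
    moreover have "(S *\<^sub>v v) $ i = (\<Sum>j<d. S $$ (i, j) * v $ j)"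
      using that S v(1) by (simp add: scalar_prod_def lessThan_atLeast0)
    ultimately show ?thesis by simp
  qed
  have "q = (\<Sum>i<d. cnj (v $ i) * (\<Sum>j<d. S $$ (i, j) * v $ j))"
    unfolding q_def by (simp add: sum_distrib_left mult.assoc)
  also have "\<dots> = k * n"
    unfolding n_def by (simp add: Sv sum_distrib_left mult.left_commute)
  finally have qn: "q = k * n" .
  have "cnj q = (\<Sum>i<d. \<Sum>j<d. v $ i * S $$ (j, i) * cnj (v $ j))"
    unfolding q_def by (simp, intro sum.cong refl, subst (2) adj, auto)
  also have "\<dots> = q"
    unfolding q_def by (subst sum.swap) (simp add: mult_ac)
  finally have cq: "cnj q = q" .
  have nr: "n = of_real (\<Sum>i<d. (cmod (v $ i))\<^sup>2)"
    unfolding n_def by (simp add: complex_norm_square mult.commute flip: of_real_power)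
  obtain i where i: "i < d" "v $ i \<noteq> 0"
    using v by (metis carrier_vecD eq_vecI index_zero_vec)
  have "(\<Sum>i<d. (cmod (v $ i))\<^sup>2) > 0"
    using i by (intro sum_pos2[of _ i]) auto
  then have "n \<noteq> 0" "cnj n = n" unfolding nr by (auto simp del: of_real_sum)
  with qn cq have "cnj k = k" by auto
  then show ?thesis using Reals_cnj_iff by blast
qed

lemma char_poly_eigenvalues_incr:
  assumes S: "S \<in> carrier_mat d d" and sa: "self_adjoint S"
  shows "char_poly S = (\<Prod>x\<leftarrow>eigenvalues_incr S. [:- complex_of_real x, 1:])"
    and length_eigenvalues_incr: "length (eigenvalues_incr S) = d"
proof -
  obtain as where as: "char_poly S = (\<Prod>a\<leftarrow>as. [:- a, 1:])" "length as = d"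
    using char_poly_factorized[OF S] by auto
  have root: "proots (char_poly S) = mset as"
  proof -
    have "proots (\<Prod>a\<leftarrow>bs. [:- a, 1:]) = mset bs" for bs :: "complex list"
    proof (induction bs)
      case (Cons b bs)
      have "(\<Prod>a\<leftarrow>bs. [:- a, 1:]) \<noteq> 0" by (subst prod_list_zero_iff) auto
      then have "proots ([:- b, 1:] * (\<Prod>a\<leftarrow>bs. [:- a, 1:])) = {#b#} + mset bs"
        using Cons by (subst proots_mult) auto
      then show ?case by (simp del: mult_pCons_left)
    qed auto
    then show ?thesis using as by simp
  qed
  have re: "complex_of_real (Re a) = a" if "a \<in> set as" for a
  proof -
    have "poly (char_poly S) a = 0"
      using that unfolding as by (induction as) auto
    then show ?thesis
      using self_adjoint_eigenvalue_real[OF S sa] eigenvalue_root_char_poly[OF S] by simp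
  qed
  have m: "mset (eigenvalues_incr S) = mset (map Re as)"
    unfolding eigenvalues_incr_def root by simp
  then show "length (eigenvalues_incr S) = d"
    using as mset_eq_length by fastforce
  have "(\<Prod>x\<leftarrow>eigenvalues_incr S. [:- complex_of_real x, 1:])
      = prod_mset (image_mset (\<lambda>x. [:- complex_of_real x, 1:]) (mset (eigenvalues_incr S)))"
    by (metis mset_map prod_mset_prod_list)
  also have "\<dots> = (\<Prod>x\<leftarrow>map Re as. [:- complex_of_real x, 1:])"
    unfolding m by (metis mset_map prod_mset_prod_list)
  also have "\<dots> = (\<Prod>a\<leftarrow>as. [:- a, 1:])"
    using re by (simp add: o_def cong: map_cong)
  finally show "char_poly S = (\<Prod>x\<leftarrow>eigenvalues_incr S. [:- complex_of_real x, 1:])"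
    using as by simp
qed

end

theory Submission
  imports Defs
begin

text \<open>
  Write \<open>a\<^sub>0 \<ge> a\<^sub>1 \<ge> \<dots>\<close> for the eigenvalues of \<open>S0\<close> and \<open>b\<^sub>0 \<le> b\<^sub>1 \<le> \<dots>\<close> for those of \<open>S1\<close>. The
  hypothesis says that the sums \<open>a\<^sub>i + b\<^sub>i\<close> are the eigenvalues of \<open>S0 + S1\<close>. Only their second
  moment matters: comparing \<open>tr ((S0 + S1)\<^sup>2) = tr (S0\<^sup>2) + 2 tr (S0 S1) + tr (S1\<^sup>2)\<close> with
  \<open>\<Sum> (a\<^sub>i + b\<^sub>i)\<^sup>2\<close> gives \<open>tr (S0 S1) = \<Sum> a\<^sub>i b\<^sub>i\<close>. This is the smallest value that the trace of a
  product can take for the two given spectra, so the claim is the equality case of von Neumann's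
  trace inequality.

  The equality case (\<open>minimal_trace_imp_commute\<close>) is a transport problem. If \<open>W\<close> is the unitary
  matrix that relates orthonormal eigenbases of \<open>S0\<close> and \<open>S1\<close>, then
  \<open>tr (S0 S1) = \<Sum>\<^sub>i \<Sum>\<^sub>j a\<^sub>i b\<^sub>j \<bar>W\<^sub>i\<^sub>j\<bar>\<^sup>2\<close>, where the weights \<open>\<bar>W\<^sub>i\<^sub>j\<bar>\<^sup>2\<close> are doubly stochastic. The
  linear program that minimises such a sum over all doubly stochastic weights has an explicit dual
  solution, and complementary slackness confines the support of an optimal weight: entries
  \<open>(i, j)\<close> and \<open>(k, l)\<close> of the support satisfy \<open>(a\<^sub>i - a\<^sub>k) (b\<^sub>j - b\<^sub>l) \<le> 0\<close>
  (\<open>minimal_coupling_support\<close>).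

  In the eigenbasis of \<open>S0\<close> the matrix \<open>S1\<close> has entries
  \<open>M\<^sub>i\<^sub>k = \<Sum>\<^sub>j b\<^sub>j W\<^sub>i\<^sub>j cnj W\<^sub>k\<^sub>j\<close>. When \<open>a\<^sub>i \<noteq> a\<^sub>k\<close>, the support condition makes \<open>b\<^sub>j\<close> constant
  over the indices \<open>j\<close> that contribute, and then \<open>M\<^sub>i\<^sub>k = 0\<close> because rows of \<open>W\<close> are orthogonal.
  So \<open>M\<close> is block diagonal along the eigenspaces of \<open>S0\<close>, which is commutation.
\<close>

section \<open>Adjoints and products of matrices\<close>

lemma mat_adjoint_carrier [simp, intro]:
  "A \<in> carrier_mat n m \<Longrightarrow> mat_adjoint A \<in> carrier_mat m n"
  by (auto simp: mat_adjoint_def mat_of_rows_def)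

lemma mat_adjoint_dim [simp]:
  "dim_row (mat_adjoint A) = dim_col A" "dim_col (mat_adjoint A) = dim_row A"
  by (auto simp: mat_adjoint_def mat_of_rows_def)

lemma mat_adjoint_index [simp]:
  fixes A :: "complex mat"
  shows "i < dim_col A \<Longrightarrow> j < dim_row A \<Longrightarrow> mat_adjoint A $$ (i, j) = cnj (A $$ (j, i))"
  by (simp add: mat_adjoint_def mat_of_rows_def)

lemma mat_adjoint_mat_adjoint:
  fixes A :: "complex mat"
  shows "mat_adjoint (mat_adjoint A) = A"
  by (rule eq_matI) auto

lemma mat_adjoint_mult:
  fixes A B :: "complex mat"
  assumes "A \<in> carrier_mat n m" "B \<in> carrier_mat m k"
  shows "mat_adjoint (A * B) = mat_adjoint B * mat_adjoint A"
  using assms by (intro eq_matI) (auto simp: scalar_prod_def mult.commute intro!: sum.cong)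

lemma mat_mult_index_sum:
  assumes "A \<in> carrier_mat n m" "B \<in> carrier_mat m k" "i < n" "j < k"
  shows "(A * B) $$ (i, j) = (\<Sum>l<m. A $$ (i, l) * B $$ (l, j))"
  using assms by (simp add: scalar_prod_def lessThan_atLeast0)

section \<open>Unitary diagonalisation with a prescribed order of the eigenvalues\<close>

text \<open>
  Gram--Schmidt applied to a basis that starts with \<open>v\<close> leaves \<open>v\<close> in place; it yields orthogonal but
  not normalised vectors, so they are rescaled here. Any nonzero multiple of \<open>v\<close> serves as first
  column of the unitary matrix, since only the line spanned by an eigenvector matters later.
\<close>

lemma unitary_with_first_column:
  fixes v :: "complex vec"
  assumes v: "v \<in> carrier_vec n" and v0: "v \<noteq> 0\<^sub>v n"
  obtains W c where "W \<in> carrier_mat n n" "mat_adjoint W * W = 1\<^sub>m n"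
    "W * mat_adjoint W = 1\<^sub>m n" "col W 0 = c \<cdot>\<^sub>v v"
proof -
  interpret cof_vec_space n "TYPE(complex)" .
  define b where "b = basis_completion v"
  define ws where "ws = gram_schmidt n b"
  have n: "0 < n"
    using v v0 by (cases n) auto
  note bc = basis_completion[OF v v0, folded b_def]
  obtain vs where bv: "b = v # vs"
    using bc(6,7) n by (cases b) auto
  note gs = gram_schmidt_result[OF bc(2,4,5) ws_def]
  have len: "length ws = n"
    using gs(4) bc(6) by simp
  have "hd ws = v"
    using gram_schmidt_hd[OF v, of vs] unfolding ws_def bv .
  then have ws0: "ws ! 0 = v"
    using len n by (metis hd_conv_nth length_0_conv less_irrefl)
  have wsc: "ws ! i \<in> carrier_vec n" if "i < n" for i
    using gs(3) len that by auto
  define r where "r i = (\<Sum>l<n. (cmod (ws ! i $ l))\<^sup>2)" for i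
  define c where "c i = complex_of_real (1 / sqrt (r i))" for i
  have ip: "ws ! i \<bullet>c ws ! j = (\<Sum>l<n. ws ! i $ l * cnj (ws ! j $ l))" if "i < n" "j < n" for i j
    using wsc[OF that(1)] wsc[OF that(2)] by (simp add: scalar_prod_def lessThan_atLeast0)
  have rr: "(\<Sum>l<n. ws ! i $ l * cnj (ws ! i $ l)) = of_real (r i)" for i
    unfolding r_def by (simp add: complex_norm_square flip: of_real_power)
  have rpos: "r i > 0" if "i < n" for i
  proof -
    have "ws ! i \<bullet>c ws ! i \<noteq> 0"
      using corthogonalD[OF gs(2), of i i] that len by simp
    then have "r i \<noteq> 0"
      using ip[OF that that] rr by simp
    moreover have "r i \<ge> 0"
      unfolding r_def by (simp add: sum_nonneg)
    ultimately show ?thesis by simp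
  qed
  define W where "W = mat n n (\<lambda>(l, i). c i * ws ! i $ l)"
  have W: "W \<in> carrier_mat n n"
    by (simp add: W_def)
  have one: "mat_adjoint W * W = 1\<^sub>m n"
  proof (rule eq_matI)
    fix i j
    assume "i < dim_row (1\<^sub>m n :: complex mat)" "j < dim_col (1\<^sub>m n :: complex mat)"
    then have ij: "i < n" "j < n" by auto
    have "(mat_adjoint W * W) $$ (i, j) = (\<Sum>l<n. cnj (W $$ (l, i)) * W $$ (l, j))"
      using ij W by (simp add: mat_mult_index_sum[of _ n n _ n] del: index_mult_mat(1))
    also have "\<dots> = (\<Sum>l<n. c i * c j * (ws ! j $ l * cnj (ws ! i $ l)))"
      using ij by (intro sum.cong) (auto simp: W_def c_def)
    also have "\<dots> = c i * c j * (ws ! j \<bullet>c ws ! i)"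
      using ip[OF ij(2,1)] by (simp add: sum_distrib_left)
    also have "\<dots> = (if i = j then 1 else 0)"
    proof (cases "i = j")
      case True
      have "c i * c i * of_real (r i) = of_real (1 / sqrt (r i) * (1 / sqrt (r i)) * r i)"
        by (simp only: c_def of_real_mult)
      also have "1 / sqrt (r i) * (1 / sqrt (r i)) * r i = 1"
        using rpos[OF ij(1)] by simp
      finally show ?thesis
        using True ip[OF ij(1) ij(1)] rr by simp
    next
      case False
      then show ?thesis
        using corthogonalD[OF gs(2), of j i] ij len by simp
    qed
    finally show "(mat_adjoint W * W) $$ (i, j) = 1\<^sub>m n $$ (i, j)"
      using ij by simp
  qed (use W in auto)
  moreover have "W * mat_adjoint W = 1\<^sub>m n"
    using mat_mult_left_right_inverse[OF _ W one] W by auto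
  moreover have "col W 0 = c 0 \<cdot>\<^sub>v v"
    using n v by (intro eq_vecI) (auto simp: W_def ws0)
  ultimately show ?thesis
    using that W by blast
qed

text \<open>
  The order of the eigenvalues must be prescribed, because the opposite orders of the two spectra are
  what the trace argument uses. The induction deflates one eigenvalue at a time, as in the Schur
  decomposition: in a basis that starts with an eigenvector for \<open>e\<close>, the first column is \<open>e\<close> times a
  unit vector, and self-adjointness clears the first row as well. The remaining block is again
  self-adjoint and its characteristic polynomial has the remaining roots.
\<close>

lemma spectral_decomposition:
  fixes A :: "complex mat"
  assumes "A \<in> carrier_mat n n" "mat_adjoint A = A"
    and "char_poly A = (\<Prod>e\<leftarrow>es. [:- e, 1:])"
  shows "\<exists>U. similar_mat_wit A (mat_diag n (\<lambda>i. es ! i)) U (mat_adjoint U)"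
  using assms
proof (induction es arbitrary: n A)
  case Nil
  then have "n = 0"
    using degree_monic_char_poly[of A n] by simp
  with Nil(1) have "similar_mat_wit A (mat_diag n (\<lambda>i. [] ! i)) (1\<^sub>m 0) (mat_adjoint (1\<^sub>m 0))"
    by (intro similar_mat_witI[of _ _ n]) auto
  then show ?case by blast
next
  case (Cons e es n A)
  note A = Cons.prems(1)
  have cp: "char_poly A = [:- e, 1:] * (\<Prod>e\<leftarrow>es. [:- e, 1:])"
    using Cons.prems(3) by simp
  have "monic (\<Prod>e\<leftarrow>es. [:- e, 1:])"
    by (rule monic_prod_list) auto
  then have "degree (char_poly A) = Suc (degree (\<Prod>e\<leftarrow>es. [:- e, 1:]))"
    unfolding cp by (subst degree_mult_eq) auto
  then obtain m where n: "n = Suc m"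
    using degree_monic_char_poly[OF A] by auto
  have "eigenvalue A e"
    unfolding eigenvalue_root_char_poly[OF A] cp by simp
  then obtain v where v: "v \<in> carrier_vec n" "v \<noteq> 0\<^sub>v n" "A *\<^sub>v v = e \<cdot>\<^sub>v v"
    using A unfolding eigenvalue_def eigenvector_def by auto
  obtain W c where W: "W \<in> carrier_mat n n" "mat_adjoint W * W = 1\<^sub>m n"
    "W * mat_adjoint W = 1\<^sub>m n" "col W 0 = c \<cdot>\<^sub>v v"
    using unitary_with_first_column[OF v(1,2)] by metis
  note Ws = mat_adjoint_carrier[OF W(1)]
  define A' where "A' = mat_adjoint W * (A * W)"
  have A': "A' \<in> carrier_mat n n"
    using A W Ws unfolding A'_def by auto
  have AA': "similar_mat_wit A A' W (mat_adjoint W)"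
  proof (rule similar_mat_witI[OF W(3,2) _ A A' W(1) Ws])
    have "W * A' = (W * mat_adjoint W) * (A * W)"
      unfolding A'_def using W(1) Ws A by (intro assoc_mult_mat[symmetric]) auto
    then have "W * A' = A * W"
      using W(1,3) A by simp
    then have "W * A' * mat_adjoint W = A * (W * mat_adjoint W)"
      using W(1) Ws A by (simp add: assoc_mult_mat[of _ n n _ n _ n])
    then show "A = W * A' * mat_adjoint W"
      using W(3) A by simp
  qed
  have herm: "mat_adjoint A' = A'"
    unfolding A'_def using W(1) Ws A Cons.prems(2)
    by (subst mat_adjoint_mult[of _ n n _ n])
      (auto simp: mat_adjoint_mult[of _ n n _ n] mat_adjoint_mat_adjoint assoc_mult_mat[of _ n n _ n _ n])
  have symm: "A' $$ (i, j) = cnj (A' $$ (j, i))" if "i < n" "j < n" for i j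
    using that A' mat_adjoint_index[of i A' j] herm by simp
  have col0: "A' $$ (i, 0) = (if i = 0 then e else 0)" if i: "i < n" for i
  proof -
    have "col (A * W) 0 = A *\<^sub>v col W 0"
      by (rule col_mult2[OF A W(1)]) (simp add: n)
    also have "\<dots> = e \<cdot>\<^sub>v col W 0"
      unfolding W(4) using A v by (auto simp: mult_mat_vec smult_smult_assoc mult.commute)
    finally have col: "col (A * W) 0 = e \<cdot>\<^sub>v col W 0" .
    have "A' $$ (i, 0) = row (mat_adjoint W) i \<bullet> col (A * W) 0"
      unfolding A'_def using A W Ws n i by simp
    also have "\<dots> = e * (row (mat_adjoint W) i \<bullet> col W 0)"
      unfolding col using W(1) Ws i
      by (intro scalar_prod_smult_distrib[of _ n]) (metis carrier_matD row_carrier col_dim)+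
    also have "row (mat_adjoint W) i \<bullet> col W 0 = (mat_adjoint W * W) $$ (i, 0)"
      using W(1) Ws i n by simp
    finally show ?thesis
      using W(2) i n by simp
  qed
  define B where "B = mat m m (\<lambda>(i, j). A' $$ (Suc i, Suc j))"
  have B: "B \<in> carrier_mat m m"
    by (simp add: B_def)
  have block: "A' = four_block_mat (mat 1 1 (\<lambda>_. e)) (0\<^sub>m 1 m) (0\<^sub>m m 1) B"
  proof (rule eq_matI)
    fix i j
    assume "i < dim_row (four_block_mat (mat 1 1 (\<lambda>_. e)) (0\<^sub>m 1 m) (0\<^sub>m m 1) B)"
      "j < dim_col (four_block_mat (mat 1 1 (\<lambda>_. e)) (0\<^sub>m 1 m) (0\<^sub>m m 1) B)"
    then have ij: "i < n" "j < n"
      by (auto simp: B_def n)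
    show "A' $$ (i, j) = four_block_mat (mat 1 1 (\<lambda>_. e)) (0\<^sub>m 1 m) (0\<^sub>m m 1) B $$ (i, j)"
    proof (cases "i = 0 \<or> j = 0")
      case True
      have "A' $$ (i, j) = (if i = 0 \<and> j = 0 then e else 0)"
        using True col0[OF ij(1)] col0[OF ij(2)] symm[OF ij] by (auto split: if_splits)
      then show ?thesis
        using True ij by (auto simp: B_def n)
    next
      case False
      then show ?thesis
        using ij by (auto simp: B_def n)
    qed
  qed (use A' in \<open>auto simp: B_def n\<close>)
  have "mat_adjoint B = B"
  proof (rule eq_matI)
    fix i j
    assume "i < dim_row B" "j < dim_col B"
    then show "mat_adjoint B $$ (i, j) = B $$ (i, j)"
      using symm[of "Suc i" "Suc j"] by (simp add: B_def n)
  qed (simp_all add: B_def)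
  moreover have "char_poly B = (\<Prod>e\<leftarrow>es. [:- e, 1:])"
  proof -
    have "[:- e, 1:] * (\<Prod>e\<leftarrow>es. [:- e, 1:]) = char_poly A'"
      using AA' cp char_poly_similar unfolding similar_mat_def by metis
    also have "\<dots> = char_poly (mat 1 1 (\<lambda>_. e)) * char_poly B"
      unfolding block by (rule char_poly_four_block_zeros_col[OF _ _ B]) auto
    also have "char_poly (mat 1 1 (\<lambda>_. e)) = [:- e, 1:]"
      by (simp add: char_poly_defs det_def sign_def)
    finally show ?thesis
      by (metis mult_cancel_left pCons_eq_0_iff zero_neq_one)
  qed
  ultimately obtain U where U: "similar_mat_wit B (mat_diag m (\<lambda>i. es ! i)) U (mat_adjoint U)"
    using Cons.IH[OF B] by blast
  note Uc = similar_mat_witD2[OF B U]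
  define V where "V = four_block_mat (1\<^sub>m 1) (0\<^sub>m 1 m) (0\<^sub>m m 1) U"
  have V: "V \<in> carrier_mat n n"
    using four_block_carrier_mat[OF one_carrier_mat[of 1] Uc(6)] by (simp add: V_def n)
  have adjV: "mat_adjoint V = four_block_mat (1\<^sub>m 1) (0\<^sub>m 1 m) (0\<^sub>m m 1) (mat_adjoint U)"
    unfolding V_def using Uc(6) by (intro eq_matI) auto
  have diag: "four_block_mat (mat 1 1 (\<lambda>_. e)) (0\<^sub>m 1 m) (0\<^sub>m m 1) (mat_diag m (\<lambda>i. es ! i))
      = mat_diag n (\<lambda>i. (e # es) ! i)"
    by (intro eq_matI) (auto simp: mat_diag_def n)
  have "similar_mat_wit A' (mat_diag n (\<lambda>i. (e # es) ! i)) V (mat_adjoint V)"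
    unfolding block diag[symmetric] adjV unfolding V_def
    by (rule similar_mat_wit_four_block[OF similar_mat_wit_refl U, of _ 1])
      (use Uc B in auto)
  from similar_mat_wit_trans[OF AA' this]
  have "similar_mat_wit A (mat_diag n (\<lambda>i. (e # es) ! i)) (W * V) (mat_adjoint (W * V))"
    using mat_adjoint_mult[OF W(1) V] by simp
  then show ?case by blast
qed

lemma self_adjoint_spectral:
  assumes S: "S \<in> carrier_mat d d" and sa: "self_adjoint S"
    and xs: "mset xs = mset (eigenvalues_incr S)"
  shows "\<exists>U. similar_mat_wit S (mat_diag d (\<lambda>i. complex_of_real (xs ! i))) U (mat_adjoint U)"
proof -
  have len: "length xs = d"
    using xs length_eigenvalues_incr[OF S sa] mset_eq_length by metis
  have "char_poly S = (\<Prod>x\<leftarrow>eigenvalues_incr S. [:- complex_of_real x, 1:])"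
    by (rule char_poly_eigenvalues_incr[OF S sa])
  also have "\<dots> = prod_mset (image_mset (\<lambda>x. [:- complex_of_real x, 1:]) (mset (eigenvalues_incr S)))"
    by (metis mset_map prod_mset_prod_list)
  also have "\<dots> = (\<Prod>x\<leftarrow>xs. [:- complex_of_real x, 1:])"
    unfolding xs[symmetric] by (metis mset_map prod_mset_prod_list)
  also have "\<dots> = (\<Prod>e\<leftarrow>map complex_of_real xs. [:- e, 1:])"
    by (simp add: o_def)
  finally obtain U where
    "similar_mat_wit S (mat_diag d (\<lambda>i. map complex_of_real xs ! i)) U (mat_adjoint U)"
    using spectral_decomposition[OF S] sa unfolding self_adjoint_def by metis
  moreover have "mat_diag d (\<lambda>i. map complex_of_real xs ! i) = mat_diag d (\<lambda>i. complex_of_real (xs ! i))"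
    using len by (auto simp: mat_diag_def)
  ultimately show ?thesis by metis
qed

section \<open>The trace\<close>

definition mat_trace :: "'a::comm_ring_1 mat \<Rightarrow> 'a" where
  "mat_trace A = (\<Sum>i<dim_row A. A $$ (i, i))"

lemma mat_trace_add:
  assumes "A \<in> carrier_mat n n" "B \<in> carrier_mat n n"
  shows "mat_trace (A + B) = mat_trace A + mat_trace B"
  using assms by (simp add: mat_trace_def sum.distrib)

lemma mat_trace_mult_commute:
  assumes A: "A \<in> carrier_mat n m" and B: "B \<in> carrier_mat m n"
  shows "mat_trace (A * B) = mat_trace (B * A)"
proof -
  have "mat_trace (A * B) = (\<Sum>i<n. \<Sum>j<m. A $$ (i, j) * B $$ (j, i))"
    using A B by (simp add: mat_trace_def mat_mult_index_sum[OF A B] del: index_mult_mat(1))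
  also have "\<dots> = (\<Sum>j<m. \<Sum>i<n. B $$ (j, i) * A $$ (i, j))"
    by (subst sum.swap) (simp add: mult.commute)
  also have "\<dots> = mat_trace (B * A)"
    using A B by (simp add: mat_trace_def mat_mult_index_sum[OF B A] del: index_mult_mat(1))
  finally show ?thesis .
qed

lemma mat_trace_similar:
  assumes A: "A \<in> carrier_mat n n" and sim: "similar_mat_wit A B P Q"
  shows "mat_trace A = mat_trace B"
proof -
  note s = similar_mat_witD2[OF A sim]
  have "mat_trace A = mat_trace (P * (B * Q))"
    using s by (metis assoc_mult_mat)
  also have "\<dots> = mat_trace (B * Q * P)"
    using s by (intro mat_trace_mult_commute[of _ n n]) auto
  also have "B * Q * P = B"
    using s by (metis assoc_mult_mat right_mult_one_mat)
  finally show ?thesis .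
qed

lemma similar_mat_wit_mult:
  assumes A: "A \<in> carrier_mat n n" and AB: "similar_mat_wit A B P Q" and AB': "similar_mat_wit A' B' P Q"
  shows "similar_mat_wit (A * A') (B * B') P Q"
proof -
  note s = similar_mat_witD2[OF A AB]
  have A': "A' \<in> carrier_mat n n"
    using similar_mat_witD[OF refl AB'] s(6) by (metis carrier_matD(1) carrier_matI)
  note s' = similar_mat_witD2[OF A' AB']
  have "A * A' = P * B * (Q * P) * B' * Q"
    using s(3-7) s'(3,5) by (simp add: assoc_mult_mat[of _ n n _ n _ n])
  also have "\<dots> = P * (B * B') * Q"
    using s(2,5-7) s'(5) by (simp add: assoc_mult_mat[of _ n n _ n _ n])
  finally show ?thesis
    using s s' by (intro similar_mat_witI[of _ _ n]) auto
qed

lemma mat_trace_square_diag: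
  assumes A: "A \<in> carrier_mat n n" and sim: "similar_mat_wit A (mat_diag n f) P Q"
  shows "mat_trace (A * A) = (\<Sum>i<n. f i * f i)"
  using mat_trace_similar[OF _ similar_mat_wit_mult[OF A sim sim, unfolded mat_diag_diag], of n] A
  by (simp add: mat_trace_def mat_diag_def)

section \<open>Optimal couplings of oppositely ordered sequences\<close>

text \<open>
  A solution of the dual of the transport problem with cost \<open>a\<^sub>i b\<^sub>j\<close> that is tight on the diagonal.
  Tightness forces \<open>v\<^sub>j = a\<^sub>j b\<^sub>j - u\<^sub>j\<close>, so the constraint becomes
  \<open>u\<^sub>i - u\<^sub>j \<le> (a\<^sub>i - a\<^sub>j) b\<^sub>j\<close>. The discrete integral \<open>u\<close> of \<open>b\<close> against the increments of \<open>a\<close>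
  satisfies it on both sides of the diagonal: the increments of \<open>a\<close> are nonpositive, and \<open>b\<close> lies
  above \<open>b\<^sub>j\<close> to the right of \<open>j\<close> and below it to the left.
\<close>

lemma antitone_coupling_dual:
  fixes a b :: "nat \<Rightarrow> real"
  assumes a: "\<And>i j. i \<le> j \<Longrightarrow> j < d \<Longrightarrow> a j \<le> a i"
    and b: "\<And>i j. i \<le> j \<Longrightarrow> j < d \<Longrightarrow> b i \<le> b j"
  obtains u v :: "nat \<Rightarrow> real" where
    "\<And>i j. i < d \<Longrightarrow> j < d \<Longrightarrow> u i + v j \<le> a i * b j"
    "\<And>i. u i + v i = a i * b i"
proof -
  define u where "u i = (\<Sum>k<i. (a (Suc k) - a k) * b k)" for i
  have up: "u i - u j \<le> (a i - a j) * b j" if "j \<le> i" "i < d" for i j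
    using that
  proof (induction i rule: dec_induct)
    case (step i)
    have "(a (Suc i) - a i) * b i \<le> (a (Suc i) - a i) * b j"
      using step a[of i "Suc i"] b[of j i] by (intro mult_left_mono_neg) auto
    with step show ?case
      by (simp add: u_def algebra_simps)
  qed simp
  have down: "u i - u j \<le> (a i - a j) * b j" if "i \<le> j" "j < d" for i j
    using that
  proof (induction j rule: dec_induct)
    case (step j)
    have "(a i - a j) * b j \<le> (a i - a j) * b (Suc j)"
      using step a[of i j] b[of j "Suc j"] by (intro mult_left_mono) auto
    moreover have "(a j - a (Suc j)) * b j \<le> (a j - a (Suc j)) * b (Suc j)"
      using step a[of j "Suc j"] b[of j "Suc j"] by (intro mult_left_mono) auto
    ultimately show ?case
      using step by (simp add: u_def algebra_simps)
  qed simp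
  show ?thesis
  proof (rule that[of u "\<lambda>j. a j * b j - u j"])
    show "u i + (a j * b j - u j) \<le> a i * b j" if "i < d" "j < d" for i j
      using up[of j i] down[of i j] that by (cases "j \<le> i") (auto simp: algebra_simps)
  qed simp
qed

text \<open>
  For doubly stochastic \<open>D\<close>, the excess of \<open>\<Sum>\<^sub>i \<Sum>\<^sub>j a\<^sub>i b\<^sub>j D\<^sub>i\<^sub>j\<close> over \<open>\<Sum> a\<^sub>i b\<^sub>i\<close> is the total of the
  nonnegative terms \<open>(a\<^sub>i b\<^sub>j - u\<^sub>i - v\<^sub>j) D\<^sub>i\<^sub>j\<close>. If there is no excess, the dual constraint is tight
  at \<open>(i, j)\<close> and \<open>(k, l)\<close>, and comparison with the constraints at \<open>(i, l)\<close> and \<open>(k, j)\<close> shows that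
  swapping the partners of \<open>i\<close> and \<open>k\<close> cannot lower the cost.
\<close>

lemma minimal_coupling_support:
  fixes a b :: "nat \<Rightarrow> real" and D :: "nat \<Rightarrow> nat \<Rightarrow> real"
  assumes a: "\<And>i j. i \<le> j \<Longrightarrow> j < d \<Longrightarrow> a j \<le> a i"
    and b: "\<And>i j. i \<le> j \<Longrightarrow> j < d \<Longrightarrow> b i \<le> b j"
    and nonneg: "\<And>i j. D i j \<ge> 0"
    and row: "\<And>i. i < d \<Longrightarrow> (\<Sum>j<d. D i j) = 1"
    and col: "\<And>j. j < d \<Longrightarrow> (\<Sum>i<d. D i j) = 1"
    and min: "(\<Sum>i<d. \<Sum>j<d. a i * b j * D i j) = (\<Sum>i<d. a i * b i)"
    and ij: "i < d" "j < d" "D i j \<noteq> 0" and kl: "k < d" "l < d" "D k l \<noteq> 0"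
  shows "(a i - a k) * (b j - b l) \<le> 0"
proof -
  obtain u v :: "nat \<Rightarrow> real" where
    le: "\<And>i j. i < d \<Longrightarrow> j < d \<Longrightarrow> u i + v j \<le> a i * b j" and
    eq: "\<And>i. u i + v i = a i * b i"
    using antitone_coupling_dual[of d a b] a b by metis
  define s where "s i j = (a i * b j - u i - v j) * D i j" for i j
  have s0: "s i j \<ge> 0" if "i < d" "j < d" for i j
    unfolding s_def using le[OF that] nonneg by simp
  have "(\<Sum>i<d. \<Sum>j<d. u i * D i j) = (\<Sum>i<d. u i)"
    using row by (simp flip: sum_distrib_left)
  moreover have "(\<Sum>i<d. \<Sum>j<d. v j * D i j) = (\<Sum>j<d. v j)"
    using col by (subst sum.swap) (simp flip: sum_distrib_left)
  moreover have "(\<Sum>i<d. a i * b i) = (\<Sum>i<d. u i) + (\<Sum>i<d. v i)"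
    by (simp add: sum.distrib flip: eq)
  ultimately have "(\<Sum>i<d. \<Sum>j<d. s i j) = 0"
    using min by (simp add: s_def left_diff_distrib sum_subtractf)
  then have "\<forall>i<d. (\<Sum>j<d. s i j) = 0"
    using s0 by (subst (asm) sum_nonneg_eq_0_iff) (auto intro!: sum_nonneg)
  then have "s i j = 0" if "i < d" "j < d" for i j
    using s0 that by (metis (no_types, lifting) finite_lessThan lessThan_iff sum_nonneg_eq_0_iff)
  then have "u i + v j = a i * b j" "u k + v l = a k * b l"
    using ij kl by (force simp: s_def)+
  moreover have "u i + v l \<le> a i * b l" "u k + v j \<le> a k * b j"
    using le ij kl by auto
  ultimately show ?thesis
    by (simp add: algebra_simps)
qed

section \<open>Equality in the trace inequality\<close>

text \<open>
  The trace condition says that the doubly stochastic matrix \<open>\<bar>W\<^sub>i\<^sub>j\<bar>\<^sup>2\<close> is an optimal coupling of \<open>a\<close>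
  and \<open>b\<close>. By the resulting restriction on its support, \<open>S1\<close> has no nonzero entry between
  eigenvectors of \<open>S0\<close> with different eigenvalues.
\<close>

lemma minimal_trace_imp_commute:
  fixes S0 S1 :: "complex mat" and a b :: "nat \<Rightarrow> real"
  assumes S0: "S0 \<in> carrier_mat d d" and S1: "S1 \<in> carrier_mat d d"
    and U: "similar_mat_wit S0 (mat_diag d (\<lambda>i. complex_of_real (a i))) U (mat_adjoint U)"
    and V: "similar_mat_wit S1 (mat_diag d (\<lambda>i. complex_of_real (b i))) V (mat_adjoint V)"
    and a: "\<And>i j. i \<le> j \<Longrightarrow> j < d \<Longrightarrow> a j \<le> a i"
    and b: "\<And>i j. i \<le> j \<Longrightarrow> j < d \<Longrightarrow> b i \<le> b j"
    and tr: "mat_trace (S0 * S1) = complex_of_real (\<Sum>i<d. a i * b i)"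
  shows "S0 * S1 = S1 * S0"
proof -
  note Uc = similar_mat_witD2[OF S0 U] and Vc = similar_mat_witD2[OF S1 V]
  define A where "A = mat_diag d (\<lambda>i. complex_of_real (a i))"
  define B where "B = mat_diag d (\<lambda>i. complex_of_real (b i))"
  define W where "W = mat_adjoint U * V"
  \<comment> \<open>\<open>M\<close> is \<open>S1\<close> written in the eigenbasis of \<open>S0\<close>.\<close>
  define M where "M = mat_adjoint U * S1 * U"
  have A: "A \<in> carrier_mat d d" and B: "B \<in> carrier_mat d d"
    by (simp_all add: A_def B_def)
  have W: "W \<in> carrier_mat d d"
    unfolding W_def using Uc(7) Vc(6) by auto
  have M: "M \<in> carrier_mat d d"
    unfolding M_def using Uc(6,7) S1 by auto
  have adjW: "mat_adjoint W = mat_adjoint V * U"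
    unfolding W_def using mat_adjoint_mult[OF Uc(7) Vc(6)] by (simp add: mat_adjoint_mat_adjoint)
  have MS1: "similar_mat_wit M S1 (mat_adjoint U) U"
    by (rule similar_mat_witI[OF Uc(2,1) M_def M S1 Uc(7,6)])
  have MB: "similar_mat_wit M B W (mat_adjoint W)"
    using similar_mat_wit_trans[OF MS1 V] unfolding adjW unfolding W_def B_def .
  note Mc = similar_mat_witD2[OF M MB]
  have M_index: "M $$ (i, k) = (\<Sum>j<d. b j * (W $$ (i, j) * cnj (W $$ (k, j))))"
    if "i < d" "k < d" for i k
  proof -
    have "M $$ (i, k) = (\<Sum>j<d. (W * B) $$ (i, j) * mat_adjoint W $$ (j, k))"
      unfolding Mc(3) using that W B by (intro mat_mult_index_sum[of _ d d _ d]) auto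
    also have "\<dots> = (\<Sum>j<d. b j * (W $$ (i, j) * cnj (W $$ (k, j))))"
      using that W unfolding B_def mat_diag_mult_right[OF W] by (intro sum.cong) auto
    finally show ?thesis .
  qed
  have rows: "(\<Sum>j<d. W $$ (i, j) * cnj (W $$ (k, j))) = (if i = k then 1 else 0)"
    if "i < d" "k < d" for i k
  proof -
    have "(W * mat_adjoint W) $$ (i, k) = (\<Sum>j<d. W $$ (i, j) * cnj (W $$ (k, j)))"
      using that W by (subst mat_mult_index_sum[of _ d d _ d]) auto
    then show ?thesis
      using Mc(1) that by simp
  qed
  define D where "D i j = (cmod (W $$ (i, j)))\<^sup>2" for i j
  have D: "complex_of_real (D i j) = W $$ (i, j) * cnj (W $$ (i, j))" for i j
    by (simp add: D_def complex_norm_square flip: of_real_power)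
  have row: "(\<Sum>j<d. D i j) = 1" if "i < d" for i
  proof -
    have "complex_of_real (\<Sum>j<d. D i j) = 1"
      using rows[OF that that] by (simp add: D)
    then show ?thesis
      using of_real_eq_1_iff by blast
  qed
  have col: "(\<Sum>i<d. D i j) = 1" if "j < d" for j
  proof -
    have "(mat_adjoint W * W) $$ (j, j) = (\<Sum>i<d. cnj (W $$ (i, j)) * W $$ (i, j))"
      using that W by (subst mat_mult_index_sum[of _ d d _ d]) auto
    then have "complex_of_real (\<Sum>i<d. D i j) = 1"
      using Mc(2) that by (simp add: D mult.commute)
    then show ?thesis
      using of_real_eq_1_iff by blast
  qed
  have S1M: "similar_mat_wit S1 M U (mat_adjoint U)"
    by (rule similar_mat_wit_sym[OF MS1])
  have S01: "similar_mat_wit (S0 * S1) (A * M) U (mat_adjoint U)"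
    unfolding A_def by (rule similar_mat_wit_mult[OF S0 U S1M])
  have S10: "similar_mat_wit (S1 * S0) (M * A) U (mat_adjoint U)"
    unfolding A_def by (rule similar_mat_wit_mult[OF S1 S1M U])
  have "mat_trace (S0 * S1) = mat_trace (A * M)"
    using mat_trace_similar[OF _ S01, of d] S0 S1 by auto
  also have "\<dots> = (\<Sum>i<d. a i * M $$ (i, i))"
    unfolding A_def mat_diag_mult_left[OF M] by (simp add: mat_trace_def)
  also have "\<dots> = (\<Sum>i<d. \<Sum>j<d. complex_of_real (a i * b j * D i j))"
    by (intro sum.cong) (auto simp: M_index D sum_distrib_left mult.assoc)
  finally have trD: "mat_trace (S0 * S1) = complex_of_real (\<Sum>i<d. \<Sum>j<d. a i * b j * D i j)"
    by simp
  have min: "(\<Sum>i<d. \<Sum>j<d. a i * b j * D i j) = (\<Sum>i<d. a i * b i)"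
    using trans[OF trD[symmetric] tr] by (simp only: of_real_eq_iff)
  have support: "(a i - a k) * (b j - b l) \<le> 0"
    if "i < d" "j < d" "k < d" "l < d" "W $$ (i, j) \<noteq> 0" "W $$ (k, l) \<noteq> 0" for i j k l
    by (rule minimal_coupling_support[of d a b D, OF a b _ row col min]) (use that in \<open>auto simp: D_def\<close>)
  have offdiag: "M $$ (i, k) = 0" if ik: "i < d" "k < d" "a i \<noteq> a k" for i k
  proof -
    have const: "b j = b l"
      if "j < d" "l < d" "W $$ (i, j) * cnj (W $$ (k, j)) \<noteq> 0" "W $$ (i, l) * cnj (W $$ (k, l)) \<noteq> 0" for j l
    proof -
      \<comment> \<open>All four entries of \<open>W\<close> in rows \<open>i\<close>, \<open>k\<close> and columns \<open>j\<close>, \<open>l\<close> are nonzero, so the support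
        condition applies along both diagonals and bounds the product from both sides.\<close>
      have "(a i - a k) * (b j - b l) = 0"
        using support[of i j k l] support[of i l k j] ik that by (simp add: algebra_simps)
      then show ?thesis
        using ik by simp
    qed
    have "\<exists>\<beta>. \<forall>j<d. W $$ (i, j) * cnj (W $$ (k, j)) \<noteq> 0 \<longrightarrow> b j = \<beta>"
      using const by metis
    then obtain \<beta> where \<beta>: "b j = \<beta>" if "j < d" "W $$ (i, j) * cnj (W $$ (k, j)) \<noteq> 0" for j
      by blast
    have "M $$ (i, k) = (\<Sum>j<d. \<beta> * (W $$ (i, j) * cnj (W $$ (k, j))))"
      unfolding M_index[OF ik(1,2)] using \<beta> by (intro sum.cong) auto
    also have "\<dots> = 0"
      using rows[OF ik(1,2)] ik(3) by (auto simp flip: sum_distrib_left)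
    finally show ?thesis .
  qed
  have "A * M = M * A"
    unfolding A_def mat_diag_mult_left[OF M] mat_diag_mult_right[OF M]
    using offdiag M by (intro eq_matI) (auto simp: mult.commute)
  then show ?thesis
    using S01 S10 unfolding similar_mat_wit_def Let_def by metis
qed

theorem theorem6p4:
  fixes S0 S1 :: "complex mat" and d :: nat
  assumes "S0 \<in> carrier_mat d d" and "S1 \<in> carrier_mat d d"
    and "self_adjoint S0" and "self_adjoint S1"
    and "eigenvalues_decr (S0 + S1) =
      decr_rearrangement (map2 (+) (eigenvalues_decr S0) (eigenvalues_incr S1))"
  shows "S0 * S1 = S1 * S0"
proof -
  note S0 = assms(1) and S1 = assms(2)
  define as where "as = eigenvalues_decr S0"
  define bs where "bs = eigenvalues_incr S1"
  define cs where "cs = map2 (+) as bs"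
  define a where "a i = as ! i" for i
  define b where "b i = bs ! i" for i
  have len: "length as = d" "length bs = d"
    unfolding as_def bs_def eigenvalues_decr_def
    using length_eigenvalues_incr S0 S1 assms(3,4) by auto
  have S: "S0 + S1 \<in> carrier_mat d d"
    using S0 S1 by auto
  have saS: "self_adjoint (S0 + S1)"
  proof -
    have "mat_adjoint (S0 + S1) = mat_adjoint S0 + mat_adjoint S1"
      using S0 S1 by (intro eq_matI) auto
    then show ?thesis
      using S0 S1 assms(3,4) by (simp add: self_adjoint_def)
  qed
  have "mset cs = mset (eigenvalues_incr (S0 + S1))"
    using arg_cong[OF assms(5), of mset]
    by (simp add: eigenvalues_decr_def[of "S0 + S1"] decr_rearrangement_def cs_def as_def bs_def)
  \<comment> \<open>The sums of the hypothesis, in any order, list the eigenvalues of \<open>S0 + S1\<close>, so \<open>cs\<close> can be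
    used without being sorted.\<close>
  then obtain X where X: "similar_mat_wit (S0 + S1)
      (mat_diag d (\<lambda>i. complex_of_real (cs ! i))) X (mat_adjoint X)"
    using self_adjoint_spectral[OF S saS] by blast
  obtain U where U: "similar_mat_wit S0 (mat_diag d (\<lambda>i. complex_of_real (a i))) U (mat_adjoint U)"
    using self_adjoint_spectral[OF S0 assms(3), of as] by (auto simp: as_def eigenvalues_decr_def a_def)
  obtain V where V: "similar_mat_wit S1 (mat_diag d (\<lambda>i. complex_of_real (b i))) V (mat_adjoint V)"
    using self_adjoint_spectral[OF S1 assms(4), of bs] by (auto simp: bs_def b_def)
  have "(S0 + S1) * (S0 + S1) = (S0 * S0 + S1 * S0) + (S0 * S1 + S1 * S1)"
    using S0 S1 by (simp add: add_mult_distrib_mat[of _ d d _ _ d] mult_add_distrib_mat[of _ d d _ d])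
  then have "mat_trace ((S0 + S1) * (S0 + S1)) = (mat_trace (S0 * S0) + mat_trace (S1 * S0))
      + (mat_trace (S0 * S1) + mat_trace (S1 * S1))"
    using S0 S1 by (simp add: mat_trace_add[of _ d])
  also have "mat_trace (S1 * S0) = mat_trace (S0 * S1)"
    by (rule mat_trace_mult_commute[OF S1 S0])
  finally have "2 * mat_trace (S0 * S1) = complex_of_real
      ((\<Sum>i<d. (cs ! i) * (cs ! i)) - (\<Sum>i<d. a i * a i) - (\<Sum>i<d. b i * b i))"
    using mat_trace_square_diag[OF S X] mat_trace_square_diag[OF S0 U] mat_trace_square_diag[OF S1 V]
    by simp
  also have "(\<Sum>i<d. (cs ! i) * (cs ! i)) = (\<Sum>i<d. (a i + b i) * (a i + b i))"
    using len by (intro sum.cong) (auto simp: cs_def a_def b_def)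
  also have "\<dots> - (\<Sum>i<d. a i * a i) - (\<Sum>i<d. b i * b i) = 2 * (\<Sum>i<d. a i * b i)"
    by (simp add: algebra_simps sum.distrib sum_distrib_left)
  finally have tr: "mat_trace (S0 * S1) = complex_of_real (\<Sum>i<d. a i * b i)"
    by simp
  have b_mono: "b i \<le> b j" if "i \<le> j" "j < d" for i j
    using that len(2) unfolding b_def bs_def eigenvalues_incr_def
    by (auto intro!: sorted_nth_mono)
  have a_mono: "a j \<le> a i" if "i \<le> j" "j < d" for i j
    using that len(1) unfolding a_def as_def eigenvalues_decr_def eigenvalues_incr_def
    by (auto intro!: sorted_rev_nth_mono)
  show ?thesis
    by (rule minimal_trace_imp_commute[OF S0 S1 U V a_mono b_mono tr])
qed

end
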